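(* Let $(X_i)_{i\ge 1}$ be non-negative random variables on a probability space and let $S_n=\sum_{i=1}^n X_i$. Suppose that $\sup_i \mathbf{E}X_i<\infty$, that $\mathbf{E}S_n\to\infty$ as $n\to\infty$, and that there exists $\gamma>1$ such that, as $n\to\infty$, \[ \mathrm{var}(S_n)=O\left(\frac{(\mathbf{E}S_n)^2}{(\log \mathbf{E}S_n)\,(\log\log \mathbf{E}S_n)^{\gamma}}\right). \] Then \[ \frac{S_n}{\mathbf{E}S_n}\to 1\quad\text{almost surely.} \]
   Context: $\mathbf{E}$ denotes expectation and $\mathrm{var}$ variance. No independence of the $X_i$ is assumed. *)

theory Defs
  imports "HOL-Probability.Probability" "HOL-Library.Landau_Symbols"
begin

definition partial_sum :: "(nat \<Rightarrow> 'a \<Rightarrow> real) \<Rightarrow> nat \<Rightarrow> 'a \<Rightarrow> real" where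
  "partial_sum X n \<omega> = (\<Sum>i=1..n. X i \<omega>)"

end

(*
  Along N k, the least index with E S_(N k) >= r^k for a fixed r > 1, the relative variances
  var S / (E S)^2 are O(1 / (k (ln k)^gamma)), hence summable, so S / E S tends to 1 almost
  surely along N. Since E X_i is bounded, E S_(N (k+1)) / E S_(N k) is eventually at most r^2,
  and monotonicity of S bounds the ratio between consecutive N k up to a factor r^2.
  Finally r decreases to 1 along a countable sequence.
*)
theory Submission
  imports Defs "HOL-Real_Asymp.Real_Asymp"
begin

section \<open>Summable series and almost sure convergence\<close>

text \<open>Cauchy condensation: the condensed terms are of order n powr (-\<gamma>), a series that
  converges for \<gamma> > 1.\<close>

lemma summable_inverse_times_ln_powr:
  fixes \<gamma> :: real
  assumes "\<gamma> > 1"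
  shows "summable (\<lambda>n::nat. 1 / (real n * ln (real n) powr \<gamma>))"
proof -
  \<comment> \<open>Shifted so as to be antitone from the start, as the condensation test demands.\<close>
  define f :: "nat \<Rightarrow> real" where "f n = 1 / ((real n + 2) * ln (real n + 2) powr \<gamma>)" for n
  have "summable (\<lambda>n. norm (real n powr (- \<gamma>)))"
    using assms by (simp add: summable_real_powr_iff)
  moreover have "(\<lambda>n. 2 ^ n * f (2 ^ n)) \<in> O(\<lambda>n. real n powr (- \<gamma>))"
    unfolding f_def using assms by real_asymp
  ultimately have "summable (\<lambda>n. 2 ^ n * f (2 ^ n))"
    by (rule summable_comparison_test_bigo)
  moreover have "f (Suc m) \<le> f m" for m
    unfolding f_def using assms
    by (intro divide_left_mono mult_mono powr_mono2 mult_pos_pos) auto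
  moreover have nonneg: "0 \<le> f n" for n
    by (simp add: f_def)
  ultimately have "summable f"
    using condensation_test[of f] by blast
  then have "summable (\<lambda>n. norm (f n))"
    using nonneg by simp
  \<comment> \<open>The shift by 2 does not change the order of decay, and big-O ignores the indices
    0 and 1, where the denominator vanishes.\<close>
  moreover have "(\<lambda>n::nat. 1 / (real n * ln (real n) powr \<gamma>)) \<in> O(f)"
    unfolding f_def using assms by real_asymp
  ultimately show ?thesis
    by (rule summable_comparison_test_bigo)
qed

text \<open>Sum and integral of nonnegative functions commute, so the pointwise sum has finite
  integral. It is therefore finite almost everywhere, and the terms of a convergent series tend to
  0.\<close>

lemma AE_tendsto_zero_if_summable_integral:
  fixes f :: "nat \<Rightarrow> 'a \<Rightarrow> real"
  assumes int: "\<forall>\<^sub>F k in sequentially. integrable M (f k)"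
    and nonneg: "\<And>k \<omega>. 0 \<le> f k \<omega>"
    and summ: "summable (\<lambda>k. integral\<^sup>L M (f k))"
  shows "AE \<omega> in M. (\<lambda>k. f k \<omega>) \<longlonglongrightarrow> 0"
proof -
  obtain K where K: "\<And>k. k \<ge> K \<Longrightarrow> integrable M (f k)"
    using int by (auto simp: eventually_sequentially)
  \<comment> \<open>Only integrable functions remain after the shift; before \<open>K\<close> the
    integral may be the default value 0. Summability and limits are unaffected by the shift.\<close>
  define g where "g k = f (k + K)" for k
  have g_int: "integrable M (g k)" for k
    unfolding g_def by (rule K) simp
  have g_meas [measurable]: "g k \<in> borel_measurable M" for k
    using g_int by auto
  have "(\<integral>\<^sup>+\<omega>. (\<Sum>k. ennreal (g k \<omega>)) \<partial>M) = (\<Sum>k. \<integral>\<^sup>+\<omega>. ennreal (g k \<omega>) \<partial>M)"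
    by (rule nn_integral_suminf) measurable
  also have "\<dots> = (\<Sum>k. ennreal (integral\<^sup>L M (g k)))"
    by (intro suminf_cong nn_integral_eq_integral g_int) (auto simp: g_def nonneg)
  also have "\<dots> = ennreal (\<Sum>k. integral\<^sup>L M (g k))"
    using summ unfolding g_def
    by (intro suminf_ennreal2 integral_nonneg_AE AE_I2 nonneg)
      (simp add: summable_iff_shift[of "\<lambda>k. integral\<^sup>L M (f k)"])
  finally have "(\<integral>\<^sup>+\<omega>. (\<Sum>k. ennreal (g k \<omega>)) \<partial>M) \<noteq> \<infinity>"
    by simp
  then have "AE \<omega> in M. (\<Sum>k. ennreal (g k \<omega>)) \<noteq> \<infinity>"
    by (intro nn_integral_PInf_AE) measurable
  then show ?thesis
  proof eventually_elim
    case (elim \<omega>)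
    then have "summable (\<lambda>k. g k \<omega>)"
      by (intro summable_suminf_not_top) (auto simp: g_def nonneg)
    then have "(\<lambda>k. f (k + K) \<omega>) \<longlonglongrightarrow> 0"
      unfolding g_def by (rule summable_LIMSEQ_zero)
    then show ?case
      by (rule LIMSEQ_offset[where f = "\<lambda>k. f k \<omega>"])
  qed
qed

section \<open>Passage from subsequences to the full sequence\<close>

text \<open>If no such \<open>k\<close> existed for some n \<ge> \<open>N K\<close>, then induction
  from \<open>K\<close> would keep every later \<open>N k\<close> at or below n, against the
  divergence of \<open>N\<close>.\<close>

lemma eventually_between_consecutive:
  fixes N :: "nat \<Rightarrow> nat"
  assumes N: "filterlim N at_top sequentially" and P: "eventually P sequentially"
  shows "\<forall>\<^sub>F n in sequentially. \<exists>k. P k \<and> N k \<le> n \<and> n < N (Suc k)"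
proof -
  obtain K where K: "\<And>k. k \<ge> K \<Longrightarrow> P k"
    using P by (auto simp: eventually_sequentially)
  have "\<exists>k. P k \<and> N k \<le> n \<and> n < N (Suc k)" if n: "n \<ge> N K" for n
  proof (rule ccontr)
    assume none: "\<not> ?thesis"
    have "N k \<le> n" if "k \<ge> K" for k
      using that
    proof (induction k rule: dec_induct)
      case base
      show ?case by (rule n)
    next
      case (step k)
      then show ?case using none K[of k] by force
    qed
    moreover obtain k0 where "\<And>k. k \<ge> k0 \<Longrightarrow> Suc n \<le> N k"
      using N by (auto simp: filterlim_at_top eventually_sequentially)
    ultimately have "N (max K k0) \<le> n" "Suc n \<le> N (max K k0)"
      by simp_all
    then show False by simp
  qed
  then show ?thesis
    by (auto simp: eventually_sequentially)
qed

text \<open>For n between consecutive indices of \<open>N m\<close>, monotonicity puts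
  \<open>s n / a n\<close> between the ratio at the left end divided by \<open>\<rho> m\<close> and
  the ratio at the right end times \<open>\<rho> m\<close>. Both end ratios tend to 1, and
  \<open>\<rho> m\<close> can be taken arbitrarily close to 1.\<close>

lemma ratio_tendsto_one_if_subsequences:
  fixes s a \<rho> :: "nat \<Rightarrow> real" and N :: "nat \<Rightarrow> nat \<Rightarrow> nat"
  assumes s: "mono s" "\<And>n. 0 \<le> s n"
    and a: "mono a" "filterlim a at_top sequentially"
    and \<rho>: "\<rho> \<longlonglongrightarrow> 1" "\<And>m. 0 < \<rho> m"
    and N: "\<And>m. filterlim (N m) at_top sequentially"
    and growth: "\<And>m. \<forall>\<^sub>F k in sequentially. a (N m (Suc k)) \<le> \<rho> m * a (N m k)"
    and lim: "\<And>m. (\<lambda>k. s (N m k) / a (N m k)) \<longlonglongrightarrow> 1"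
  shows "(\<lambda>n. s n / a n) \<longlonglongrightarrow> 1"
proof (rule order_tendstoI)
  have pos: "\<forall>\<^sub>F n in sequentially. 0 < a n"
    using a(2) by (auto simp: filterlim_at_top_dense)
  have pos_N: "\<forall>\<^sub>F k in sequentially. 0 < a (N m k)" for m
    using filterlim_compose[OF a(2) N[of m]] by (auto simp: filterlim_at_top_dense)
  {
    fix c :: real assume "c < 1"
    moreover have "(\<lambda>m. c * \<rho> m) \<longlonglongrightarrow> c * 1"
      by (intro tendsto_intros \<rho>(1))
    \<comment> \<open>This \<open>m\<close> is chosen so that the loss factor
      \<open>\<rho> m\<close> fits into the gap between \<open>c\<close> and 1.\<close>
    ultimately obtain m where m: "c * \<rho> m < 1"
      using order_tendstoD(2)[of "\<lambda>m. c * \<rho> m" c sequentially 1]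
      by (auto simp: eventually_sequentially)
    have "\<forall>\<^sub>F k in sequentially. c * \<rho> m < s (N m k) / a (N m k) \<and> 0 < a (N m k)
      \<and> a (N m (Suc k)) \<le> \<rho> m * a (N m k)"
      by (intro eventually_conj order_tendstoD(1)[OF lim m] pos_N growth)
    from eventually_between_consecutive[OF N[of m] this] pos
    show "\<forall>\<^sub>F n in sequentially. c < s n / a n"
    proof eventually_elim
      case (elim n)
      then obtain k where k: "c * \<rho> m < s (N m k) / a (N m k)" "0 < a (N m k)"
        "a (N m (Suc k)) \<le> \<rho> m * a (N m k)" "N m k \<le> n" "n < N m (Suc k)"
        by blast
      have "a n \<le> \<rho> m * a (N m k)"
        using monoD[OF a(1), of n "N m (Suc k)"] k by linarith
      moreover have "s (N m k) \<le> s n"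
        using monoD[OF s(1)] k by blast
      ultimately have "s (N m k) / (\<rho> m * a (N m k)) \<le> s n / a n"
        using s(2) elim by (intro frac_le) auto
      moreover have "c < s (N m k) / (\<rho> m * a (N m k))"
        using k \<rho>(2)[of m] by (simp add: field_simps)
      ultimately show ?case by linarith
    qed
  next
    fix c :: real assume "1 < c"
    then obtain m where "\<rho> m < c"
      using order_tendstoD(2)[OF \<rho>(1)] by (auto simp: eventually_sequentially)
    \<comment> \<open>Used twice: the ratios along \<open>N m\<close> eventually fall below this
      quotient, and its positivity allows multiplying the growth bound by it.\<close>
    then have m: "1 < c / \<rho> m"
      using \<rho>(2)[of m] by simp
    have "\<forall>\<^sub>F k in sequentially. s (N m k) / a (N m k) < c / \<rho> m"
      by (rule order_tendstoD(2)[OF lim m])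
    \<comment> \<open>The upper bound compares with the right end of the block, hence the index
      shift.\<close>
    then have "\<forall>\<^sub>F k in sequentially. s (N m (Suc k)) / a (N m (Suc k)) < c / \<rho> m"
      using eventually_sequentially_Suc[of "\<lambda>k. s (N m k) / a (N m k) < c / \<rho> m"] by simp
    then have "\<forall>\<^sub>F k in sequentially. s (N m (Suc k)) / a (N m (Suc k)) < c / \<rho> m
      \<and> 0 < a (N m k) \<and> a (N m (Suc k)) \<le> \<rho> m * a (N m k)"
      by (intro eventually_conj pos_N growth)
    from eventually_between_consecutive[OF N[of m] this]
    show "\<forall>\<^sub>F n in sequentially. s n / a n < c"
    proof eventually_elim
      case (elim n)
      then obtain k where k: "s (N m (Suc k)) / a (N m (Suc k)) < c / \<rho> m" "0 < a (N m k)"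
        "a (N m (Suc k)) \<le> \<rho> m * a (N m k)" "N m k \<le> n" "n < N m (Suc k)"
        by blast
      have le: "a (N m k) \<le> a n" "a n \<le> a (N m (Suc k))" "s n \<le> s (N m (Suc k))"
        using monoD[OF a(1)] monoD[OF s(1)] k by simp_all
      have "s n / a n \<le> s (N m (Suc k)) / a (N m k)"
        using s(2) le k by (intro frac_le) auto
      also have "\<dots> < c"
      proof -
        have "s (N m (Suc k)) < c / \<rho> m * a (N m (Suc k))"
          using k le by (simp add: pos_divide_less_eq)
        also have "\<dots> \<le> c / \<rho> m * (\<rho> m * a (N m k))"
          using k m by (intro mult_left_mono) auto
        also have "\<dots> = c * a (N m k)"
          using \<rho>(2)[of m] by simp
        finally show ?thesis
          using k by (simp add: pos_divide_less_eq)
      qed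
      finally show ?case .
    qed
  }
qed

section \<open>The geometric subsequence and its relative variances\<close>

text \<open>Take the first index at which \<open>a\<close> reaches \<open>r ^ k\<close>. Just before
  \<open>N (Suc k)\<close> the value is still below \<open>r ^ Suc k\<close>, and one step adds at
  most \<open>C\<close>. The exponent 2 in the growth bound leaves room to absorb
  \<open>C\<close>.\<close>

lemma geometric_subsequence:
  fixes a :: "nat \<Rightarrow> real"
  assumes a: "mono a" "filterlim a at_top sequentially"
    and step: "\<And>n. a (Suc n) \<le> a n + C" and r: "1 < r"
  obtains N :: "nat \<Rightarrow> nat" where "filterlim N at_top sequentially" "\<And>k. r ^ k \<le> a (N k)"
    "\<forall>\<^sub>F k in sequentially. a (N (Suc k)) \<le> r\<^sup>2 * a (N k)"
proof
  define N where "N k = (LEAST n. r ^ k \<le> a n)" for k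
  have "\<exists>n. r ^ k \<le> a n" for k
    using a(2) by (auto simp: filterlim_at_top eventually_sequentially)
  then show N_ge: "r ^ k \<le> a (N k)" for k
    unfolding N_def by (rule LeastI_ex)
  have pow: "filterlim (\<lambda>k. r ^ k) at_top sequentially"
    using r by real_asymp
  show lim: "filterlim N at_top sequentially"
    unfolding filterlim_at_top
  proof
    fix n
    \<comment> \<open>Once \<open>r ^ k\<close> exceeds \<open>a n\<close>, no index up to
      \<open>n\<close> can reach it, because \<open>a\<close> is monotone.\<close>
    have "\<forall>\<^sub>F k in sequentially. a n < r ^ k"
      using pow by (auto simp: filterlim_at_top_dense)
    then show "\<forall>\<^sub>F k in sequentially. n \<le> N k"
    proof eventually_elim
      case (elim k)
      then have "a n < a (N k)"
        using N_ge[of k] by linarith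
      then show ?case
        using monoD[OF a(1), of "N k" n] by force
    qed
  qed
  \<comment> \<open>Ensures that \<open>N (Suc k) - 1\<close> is a genuine predecessor despite
    truncated subtraction.\<close>
  have "\<forall>\<^sub>F k in sequentially. 1 \<le> N k"
    using lim unfolding filterlim_at_top by blast
  then have "\<forall>\<^sub>F k in sequentially. 1 \<le> N (Suc k)"
    using eventually_sequentially_Suc[of "\<lambda>k. 1 \<le> N k"] by simp
  moreover have "\<forall>\<^sub>F k in sequentially. r ^ Suc k + C \<le> r\<^sup>2 * r ^ k"
  proof -
    \<comment> \<open>The threshold comes from r^(k+2) - r^(k+1) = r^k r (r - 1), the room available
      for \<open>C\<close>.\<close>
    have "\<forall>\<^sub>F k in sequentially. C / (r * (r - 1)) \<le> r ^ k"
      using pow by (auto simp: filterlim_at_top)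
    then show ?thesis
    proof eventually_elim
      case (elim k)
      then have "C \<le> r ^ k * (r * (r - 1))"
        using r by (simp add: pos_divide_le_eq)
      then show ?case
        by (simp add: algebra_simps power2_eq_square)
    qed
  qed
  ultimately show "\<forall>\<^sub>F k in sequentially. a (N (Suc k)) \<le> r\<^sup>2 * a (N k)"
  proof eventually_elim
    case (elim k)
    then have "\<not> r ^ Suc k \<le> a (N (Suc k) - 1)"
      unfolding N_def by (intro not_less_Least) (simp flip: N_def)
    then have "a (N (Suc k)) \<le> r ^ Suc k + C"
      using step[of "N (Suc k) - 1"] elim by simp
    also have "\<dots> \<le> r\<^sup>2 * r ^ k"
      by (rule elim)
    also have "\<dots> \<le> r\<^sup>2 * a (N k)"
      using N_ge by (intro mult_left_mono) auto
    finally show ?case .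
  qed
qed

text \<open>From \<open>r ^ k \<le> a (N k)\<close> follows k ln r \<le> ln (a (N k)). Since x (ln
  x)^\<gamma> increases for x > 1, this lower bound alone dominates the terms by the convergent
  logarithmic series.\<close>

lemma summable_along_geometric:
  fixes v a :: "nat \<Rightarrow> real"
  assumes v: "v \<in> O(\<lambda>n. (a n)\<^sup>2 / (ln (a n) * ln (ln (a n)) powr \<gamma>))" and \<gamma>: "1 < \<gamma>"
    and r: "1 < r" and N: "filterlim N at_top sequentially" "\<And>k. r ^ k \<le> a (N k)"
  shows "summable (\<lambda>k. v (N k) / (a (N k))\<^sup>2)"
proof (rule summable_comparison_test_bigo)
  let ?g = "\<lambda>k::nat. 1 / (real k * ln (real k) powr \<gamma>)"
  show "summable (\<lambda>k. norm (?g k))"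
    using summable_inverse_times_ln_powr[OF \<gamma>] by simp
  have a_pos: "0 < a (N k)" for k
    using N(2)[of k] r by (meson less_le_trans less_trans zero_less_one zero_less_power)
  have "(\<lambda>k. v (N k)) \<in> O(\<lambda>k. (a (N k))\<^sup>2 / (ln (a (N k)) * ln (ln (a (N k))) powr \<gamma>))"
    by (rule landau_o.big.compose[OF v N(1)])
  then have "(\<lambda>k. v (N k) / (a (N k))\<^sup>2) \<in>
      O(\<lambda>k. (a (N k))\<^sup>2 / (ln (a (N k)) * ln (ln (a (N k))) powr \<gamma>) / (a (N k))\<^sup>2)"
    by (rule landau_o.big.divide_right[rotated]) (use a_pos in \<open>auto simp: less_imp_neq[symmetric]\<close>)
  also have "(\<lambda>k. (a (N k))\<^sup>2 / (ln (a (N k)) * ln (ln (a (N k))) powr \<gamma>) / (a (N k))\<^sup>2) =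
      (\<lambda>k. 1 / (ln (a (N k)) * ln (ln (a (N k))) powr \<gamma>))"
    using a_pos by (auto simp: fun_eq_iff less_imp_neq[symmetric])
  also have "\<dots> \<in> O(\<lambda>k. 1 / (real k * ln r * ln (real k * ln r) powr \<gamma>))"
  proof (rule landau_o.big_mono)
    have "filterlim (\<lambda>k::nat. real k * ln r) at_top sequentially"
      using r by real_asymp
    \<comment> \<open>Beyond 1 the outer and iterated logarithms are positive, so the norms drop out
      and the denominators compare factor by factor.\<close>
    then have "\<forall>\<^sub>F k in sequentially. 1 < real k * ln r"
      by (auto simp: filterlim_at_top_dense)
    then show "\<forall>\<^sub>F k in sequentially. norm (1 / (ln (a (N k)) * ln (ln (a (N k))) powr \<gamma>))
        \<le> norm (1 / (real k * ln r * ln (real k * ln r) powr \<gamma>))"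
    proof eventually_elim
      case (elim k)
      define x where "x = real k * ln r"
      have x: "1 < x"
        using elim by (simp add: x_def)
      have "x = ln (r ^ k)"
        using r by (simp add: x_def ln_realpow)
      also have "\<dots> \<le> ln (a (N k))"
        using N(2)[of k] r a_pos[of k] by simp
      finally have le: "x \<le> ln (a (N k))" .
      then have lnln: "0 < ln x" "ln x \<le> ln (ln (a (N k)))"
        using x by simp_all
      have "1 / (ln (a (N k)) * ln (ln (a (N k))) powr \<gamma>) \<le> 1 / (x * ln x powr \<gamma>)"
        using le lnln x \<gamma> by (intro divide_left_mono mult_mono powr_mono2 mult_pos_pos) simp_all
      then show ?case
        using le x by (simp add: abs_mult flip: x_def)
    qed
  qed
  also have "(\<lambda>k::nat. 1 / (real k * ln r * ln (real k * ln r) powr \<gamma>)) \<in> O(?g)"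
    using r \<gamma> by real_asymp
  finally show "(\<lambda>k. v (N k) / (a (N k))\<^sup>2) \<in> O(?g)" .
qed

section \<open>Almost sure convergence of the normalised sums\<close>

text \<open>Finite second moments for large n are stated explicitly: the integral of a
  non-integrable function is 0 by default, so the bound on \<open>variance\<close> would otherwise
  not express a finite variance.\<close>

theorem theorem1:
  fixes M :: "'a measure" and X :: "nat \<Rightarrow> 'a \<Rightarrow> real" and \<gamma> :: real
  assumes "prob_space M"
    and "\<And>i. i \<ge> 1 \<Longrightarrow> X i \<in> borel_measurable M"
    and "\<And>i. i \<ge> 1 \<Longrightarrow> AE \<omega> in M. 0 \<le> X i \<omega>"
    and "\<And>i. i \<ge> 1 \<Longrightarrow> integrable M (X i)"
    and "bdd_above ((\<lambda>i. prob_space.expectation M (X i)) ` {1..})"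
    and "filterlim (\<lambda>n. prob_space.expectation M (partial_sum X n)) at_top sequentially"
    and "\<gamma> > 1"
    and "\<forall>\<^sub>F n in sequentially. integrable M (\<lambda>\<omega>. (partial_sum X n \<omega>)\<^sup>2)"
    and "(\<lambda>n. prob_space.variance M (partial_sum X n)) \<in>
           O(\<lambda>n. (prob_space.expectation M (partial_sum X n))\<^sup>2 /
                  (ln (prob_space.expectation M (partial_sum X n)) *
                   (ln (ln (prob_space.expectation M (partial_sum X n)))) powr \<gamma>))"
  shows "AE \<omega> in M. (\<lambda>n. partial_sum X n \<omega> / prob_space.expectation M (partial_sum X n))
           \<longlonglongrightarrow> 1"
proof -
  interpret prob_space M by fact
  note nonneg = assms(3) and int = assms(4)
  let ?S = "partial_sum X"
  define a where "a n = expectation (?S n)" for n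
  have S_int: "integrable M (?S n)" for n
    unfolding partial_sum_def[abs_def] using int by auto
  have a_Suc: "a (Suc n) = a n + expectation (X (Suc n))" for n
  proof -
    have "?S (Suc n) = (\<lambda>\<omega>. ?S n \<omega> + X (Suc n) \<omega>)"
      by (simp add: partial_sum_def fun_eq_iff)
    then show ?thesis
      unfolding a_def using S_int int[of "Suc n"] by simp
  qed
  obtain C where C: "\<And>i. i \<ge> 1 \<Longrightarrow> expectation (X i) \<le> C"
    using assms(5) by (auto simp: bdd_above_def)
  have a_step: "a (Suc n) \<le> a n + C" for n
    using C[of "Suc n"] by (simp add: a_Suc)
  have a_mono: "mono a"
    using integral_nonneg_AE[OF nonneg] by (intro incseq_SucI) (simp add: a_Suc)
  have a_lim: "filterlim a at_top sequentially"
    using assms(6) by (simp add: a_def[abs_def])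

  \<comment> \<open>A countable family of ratios above 1 with limit 1, so that the exceptional null
    sets can be united.\<close>
  define r where "r m = 1 + 1 / real (Suc m)" for m
  have r: "1 < r m" for m
    by (simp add: r_def)
  have "\<forall>m. \<exists>N. filterlim N at_top sequentially \<and> (\<forall>k. r m ^ k \<le> a (N k)) \<and>
      (\<forall>\<^sub>F k in sequentially. a (N (Suc k)) \<le> (r m)\<^sup>2 * a (N k))"
    using geometric_subsequence[OF a_mono a_lim a_step r] by metis
  then obtain N where N: "\<And>m. filterlim (N m) at_top sequentially"
      "\<And>m k. r m ^ k \<le> a (N m k)"
      "\<And>m. \<forall>\<^sub>F k in sequentially. a (N m (Suc k)) \<le> (r m)\<^sup>2 * a (N m k)"
    by metis

  have subseq: "AE \<omega> in M. (\<lambda>k. ?S (N m k) \<omega> / a (N m k)) \<longlonglongrightarrow> 1" for m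
  proof -
    have a_pos: "0 < a (N m k)" for k
      using N(2)[of m k] r[of m] by (meson less_le_trans less_trans zero_less_one zero_less_power)
    \<comment> \<open>Taking expectations turns the squared relative deviation into the variance
      over the squared mean, which is the summable quantity.\<close>
    have dev_sq: "(?S (N m k) \<omega> / a (N m k) - 1)\<^sup>2 = (?S (N m k) \<omega> - a (N m k))\<^sup>2 / (a (N m k))\<^sup>2"
      for k \<omega>
      using a_pos[of k] by (simp add: diff_divide_distrib flip: power_divide)
    have "AE \<omega> in M. (\<lambda>k. (?S (N m k) \<omega> / a (N m k) - 1)\<^sup>2) \<longlonglongrightarrow> 0"
    proof (rule AE_tendsto_zero_if_summable_integral)
      show "\<forall>\<^sub>F k in sequentially. integrable M (\<lambda>\<omega>. (?S (N m k) \<omega> / a (N m k) - 1)\<^sup>2)"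
        using eventually_compose_filterlim[OF assms(8) N(1)[of m]]
      proof eventually_elim
        case (elim k)
        then have "integrable M (\<lambda>\<omega>. (?S (N m k) \<omega>)\<^sup>2 + (a (N m k))\<^sup>2
            - 2 * ?S (N m k) \<omega> * a (N m k))"
          using S_int by auto
        then show ?case
          unfolding dev_sq unfolding power2_diff by simp
      qed
      have "summable (\<lambda>k. variance (?S (N m k)) / (a (N m k))\<^sup>2)"
        using assms(9) unfolding a_def[symmetric]
        by (intro summable_along_geometric[OF _ assms(7) r N(1,2)])
      then show "summable (\<lambda>k. expectation (\<lambda>\<omega>. (?S (N m k) \<omega> / a (N m k) - 1)\<^sup>2))"
        unfolding dev_sq unfolding a_def by simp
    qed simp
    then show ?thesis
    proof eventually_elim
      case (elim \<omega>)
      then have "(\<lambda>k. sqrt ((?S (N m k) \<omega> / a (N m k) - 1)\<^sup>2)) \<longlonglongrightarrow> sqrt 0"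
        by (rule tendsto_real_sqrt)
      then show ?case
        by (simp add: tendsto_rabs_zero_iff LIM_zero_iff)
    qed
  qed

  \<comment> \<open>Countably many null sets are discarded at once; for each remaining \<omega> the
    rest of the argument is deterministic.\<close>
  have "AE \<omega> in M. \<forall>i\<in>{1..}. 0 \<le> X i \<omega>"
    using nonneg by (simp add: AE_ball_countable)
  moreover have "AE \<omega> in M. \<forall>m. (\<lambda>k. ?S (N m k) \<omega> / a (N m k)) \<longlonglongrightarrow> 1"
    using subseq by (simp add: AE_all_countable)
  ultimately show ?thesis
    unfolding a_def[symmetric]
  proof eventually_elim
    case (elim \<omega>)
    show ?case
    proof (rule ratio_tendsto_one_if_subsequences)
      show "mono (\<lambda>n. ?S n \<omega>)"
        using elim by (intro incseq_SucI) (simp add: partial_sum_def)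
      show "0 \<le> ?S n \<omega>" for n
        using elim by (auto simp: partial_sum_def intro!: sum_nonneg)
      show "(\<lambda>m. (r m)\<^sup>2) \<longlonglongrightarrow> 1"
        unfolding r_def by real_asymp
      show "0 < (r m)\<^sup>2" for m
        using r[of m] by simp
    qed (use elim a_mono a_lim N in auto)
  qed
qed

end
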